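(* Let $R$ be a commutative ring with identity, $I$ an ideal of $R$, and $P$ a proper ideal of $R$. Then the following are equivalent: (1) $P$ is $I$-prime. (2) For every $x \in R - P$, $(P:x) = P \cup (IP:x)$. (3) For every $x \in R - P$, $(P:x) = P$ or $(P:x) = (IP:x)$. (4) For all ideals $J$ and $K$ of $R$, $JK \subseteq P$ and $JK \nsubseteq IP$ imply $J \subseteq P$ or $K \subseteq P$.
   Context: For an ideal $I$ of a commutative ring $R$ with identity, a proper ideal $P$ of $R$ is called $I$-prime if for all $a, b \in R$, $ab \in P - IP$ (that is, $ab \in P$ and $ab \notin IP$) implies $a \in P$ or $b \in P$. For an ideal $A$ of $R$ and $x \in R$, $(A:x) = \{r \in R : rx \in A\}$. *)

theory Defs
  imports "HOL-Algebra.Ideal_Product"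
begin

definition I_prime :: "('a, 'b) ring_scheme \<Rightarrow> 'a set \<Rightarrow> 'a set \<Rightarrow> bool" where
  "I_prime R I P \<longleftrightarrow>
     ideal P R \<and> P \<noteq> carrier R \<and>
     (\<forall>a\<in>carrier R. \<forall>b\<in>carrier R.
        a \<otimes>\<^bsub>R\<^esub> b \<in> P - I \<cdot>\<^bsub>R\<^esub> P \<longrightarrow> a \<in> P \<or> b \<in> P)"

definition colon_ideal :: "('a, 'b) ring_scheme \<Rightarrow> 'a set \<Rightarrow> 'a \<Rightarrow> 'a set" where
  "colon_ideal R A x = {r \<in> carrier R. r \<otimes>\<^bsub>R\<^esub> x \<in> A}"

end

theory Submission
  imports Defs
begin

text \<open>
  The product \<open>I \<cdot> P\<close> enters all four conditions only as an ideal contained in \<open>P\<close>, so the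
  equivalences are proved for an arbitrary ideal \<open>Q \<subseteq> P\<close> in its place.

  Reading \<open>a \<otimes> x \<in> P\<close> as \<open>a \<in> (P : x)\<close>, the prime condition for a fixed factor \<open>x\<close> outside \<open>P\<close>
  says exactly that \<open>(P : x)\<close> is covered by \<open>P\<close> and \<open>(Q : x)\<close>; both of these lie in \<open>(P : x)\<close>
  anyway, which is the equivalence with the union condition. All sets involved are ideals, and an
  additive subgroup is never the union of two proper subgroups, so the covering forces \<open>(P : x)\<close>
  to coincide with one of the two.

  The condition on ideals \<open>J\<close> and \<open>K\<close> specialises to elements by taking principal ideals. For the
  converse, suppose \<open>J \<cdot> K \<subseteq> P\<close> while neither factor lies in \<open>P\<close>. If \<open>a \<in> J\<close> is outside \<open>P\<close>, then
  \<open>K \<subseteq> (P : a)\<close> excludes \<open>(P : a) = P\<close>, so \<open>(P : a) = (Q : a)\<close> and all of \<open>a K\<close> lies in \<open>Q\<close>.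
  Elements of \<open>J\<close> inside \<open>P\<close> are handled by translation: adding a fixed \<open>j \<in> J - P\<close> moves them
  out of \<open>P\<close>, and \<open>(a + j) k\<close> and \<open>j k\<close> in \<open>Q\<close> give \<open>a k\<close> in \<open>Q\<close>. Hence \<open>J \<cdot> K \<subseteq> Q\<close>.
\<close>

definition prime_outside :: "('a, 'b) ring_scheme \<Rightarrow> 'a set \<Rightarrow> 'a set \<Rightarrow> bool" where
  "prime_outside R Q P \<longleftrightarrow>
     (\<forall>a\<in>carrier R. \<forall>b\<in>carrier R. a \<otimes>\<^bsub>R\<^esub> b \<in> P - Q \<longrightarrow> a \<in> P \<or> b \<in> P)"

lemma mem_colon_ideal_iff:
  "r \<in> colon_ideal R A x \<longleftrightarrow> r \<in> carrier R \<and> r \<otimes>\<^bsub>R\<^esub> x \<in> A"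
  by (simp add: colon_ideal_def)

lemma colon_ideal_mono: "A \<subseteq> B \<Longrightarrow> colon_ideal R A x \<subseteq> colon_ideal R B x"
  by (auto simp: colon_ideal_def)

context cring
begin

lemma ideal_subset_colon_ideal:
  assumes "ideal A R" "x \<in> carrier R"
  shows "A \<subseteq> colon_ideal R A x"
  using assms by (auto simp: mem_colon_ideal_iff ideal.Icarr ideal.I_r_closed)

lemma additive_subgroup_colon_ideal:
  assumes A: "ideal A R" and x: "x \<in> carrier R"
  shows "additive_subgroup (colon_ideal R A x) R"
proof -
  interpret A: ideal A R by (fact A)
  show ?thesis
  proof (intro additive_subgroup.intro add.subgroupI)
    show "colon_ideal R A x \<subseteq> carrier R"
      by (auto simp: mem_colon_ideal_iff)
    have "\<zero> \<in> colon_ideal R A x"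
      using x by (simp add: mem_colon_ideal_iff)
    then show "colon_ideal R A x \<noteq> {}" by blast
  next
    fix a assume "a \<in> colon_ideal R A x"
    then show "\<ominus> a \<in> colon_ideal R A x"
      using x by (simp add: mem_colon_ideal_iff l_minus)
  next
    fix a b assume "a \<in> colon_ideal R A x" "b \<in> colon_ideal R A x"
    then show "a \<oplus> b \<in> colon_ideal R A x"
      using x by (simp add: mem_colon_ideal_iff l_distr)
  qed
qed

lemma add_mem_cancel_right:
  assumes "additive_subgroup H R" "a \<in> carrier R" "b \<in> H" "a \<oplus> b \<in> H"
  shows "a \<in> H"
proof -
  interpret additive_subgroup H R by (fact assms(1))
  have "(a \<oplus> b) \<oplus> \<ominus> b \<in> H"
    using assms by simp
  moreover have "(a \<oplus> b) \<oplus> \<ominus> b = a"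
    using assms by (simp add: a_assoc r_neg)
  ultimately show ?thesis by simp
qed

text \<open>
  If \<open>h \<in> H - K\<close> and \<open>k \<in> K - H\<close>, then \<open>h \<oplus> k\<close> belongs to \<open>H \<union> K\<close> but cancelling one of the
  summands shows that it belongs to neither.
\<close>

lemma additive_subgroup_eq_Un:
  assumes G: "additive_subgroup G R" and H: "additive_subgroup H R" and K: "additive_subgroup K R"
    and eq: "G = H \<union> K"
  shows "G = H \<or> G = K"
proof (rule ccontr)
  assume "\<not> ?thesis"
  then obtain h k where hk: "h \<in> H" "h \<notin> K" "k \<in> K" "k \<notin> H"
    using eq by blast
  have carr: "h \<in> carrier R" "k \<in> carrier R"
    using hk H K by (auto dest: additive_subgroup.a_Hcarr)
  have "h \<oplus> k \<in> G"
    using additive_subgroup.a_closed[OF G] hk eq by blast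
  then consider "k \<oplus> h \<in> H" | "h \<oplus> k \<in> K"
    using eq carr by (auto simp: a_comm)
  then show False
    using add_mem_cancel_right[OF H] add_mem_cancel_right[OF K] hk carr by cases blast+
qed

lemma prime_outside_iff_colon_eq_Un:
  assumes P: "ideal P R" and QP: "Q \<subseteq> P"
  shows "prime_outside R Q P \<longleftrightarrow>
    (\<forall>x \<in> carrier R - P. colon_ideal R P x = P \<union> colon_ideal R Q x)"
proof -
  have "P \<union> colon_ideal R Q x \<subseteq> colon_ideal R P x" if "x \<in> carrier R" for x
    using ideal_subset_colon_ideal[OF P that] colon_ideal_mono[OF QP, of R x] by blast
  moreover have "prime_outside R Q P \<longleftrightarrow>
      (\<forall>x \<in> carrier R - P. colon_ideal R P x \<subseteq> P \<union> colon_ideal R Q x)"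
    by (auto simp: prime_outside_def colon_ideal_def)
  ultimately show ?thesis by blast
qed

lemma prime_outside_iff_colon_eq_or_eq:
  assumes P: "ideal P R" and Q: "ideal Q R" and QP: "Q \<subseteq> P"
  shows "prime_outside R Q P \<longleftrightarrow>
    (\<forall>x \<in> carrier R - P. colon_ideal R P x = P \<or> colon_ideal R P x = colon_ideal R Q x)"
proof
  assume "prime_outside R Q P"
  then have un: "colon_ideal R P x = P \<union> colon_ideal R Q x" if "x \<in> carrier R - P" for x
    using that by (simp add: prime_outside_iff_colon_eq_Un[OF P QP])
  show "\<forall>x \<in> carrier R - P. colon_ideal R P x = P \<or> colon_ideal R P x = colon_ideal R Q x"
  proof
    fix x assume x: "x \<in> carrier R - P"
    show "colon_ideal R P x = P \<or> colon_ideal R P x = colon_ideal R Q x"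
    proof (rule additive_subgroup_eq_Un)
      show "colon_ideal R P x = P \<union> colon_ideal R Q x" by (rule un[OF x])
    qed (use x P Q in \<open>auto intro: additive_subgroup_colon_ideal ideal.axioms(1)\<close>)
  qed
next
  assume "\<forall>x \<in> carrier R - P. colon_ideal R P x = P \<or> colon_ideal R P x = colon_ideal R Q x"
  then show "prime_outside R Q P"
    unfolding prime_outside_def using mem_colon_ideal_iff[of _ R] by blast
qed

text \<open>
  A multiplier outside \<open>P\<close> that sends \<open>K\<close> into \<open>P\<close> sends it into \<open>Q\<close>: the alternative
  \<open>(P : a) = P\<close> is ruled out by any element of \<open>K\<close> outside \<open>P\<close>.
\<close>

lemma prime_outside_mult_mem:
  assumes P: "ideal P R" and Q: "ideal Q R" and QP: "Q \<subseteq> P" and prime: "prime_outside R Q P"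
    and a: "a \<in> carrier R" "a \<notin> P"
    and K: "K \<subseteq> carrier R" "\<not> K \<subseteq> P" and KP: "\<And>k. k \<in> K \<Longrightarrow> a \<otimes> k \<in> P"
    and k: "k \<in> K"
  shows "a \<otimes> k \<in> Q"
proof -
  have sub: "K \<subseteq> colon_ideal R P a"
    using K KP a by (auto simp: mem_colon_ideal_iff m_comm subset_iff)
  then have "colon_ideal R P a = colon_ideal R Q a"
    using prime a K by (auto simp: prime_outside_iff_colon_eq_or_eq[OF P Q QP])
  then have "k \<otimes> a \<in> Q"
    using sub k by (auto simp: mem_colon_ideal_iff)
  then show ?thesis
    using a K k by (simp add: m_comm subset_iff)
qed

lemma ideal_prod_subset:
  assumes A: "ideal A R" and "\<And>j k. j \<in> J \<Longrightarrow> k \<in> K \<Longrightarrow> j \<otimes> k \<in> A"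
  shows "J \<cdot> K \<subseteq> A"
proof
  fix s assume "s \<in> J \<cdot> K"
  then show "s \<in> A"
    using assms(2) additive_subgroup.a_closed[OF ideal.axioms(1)[OF A]]
    by (induct s rule: ideal_prod.induct) auto
qed

lemma prime_outside_ideal_prod:
  assumes P: "ideal P R" and Q: "ideal Q R" and QP: "Q \<subseteq> P" and prime: "prime_outside R Q P"
    and J: "ideal J R" and K: "ideal K R" and JKP: "J \<cdot> K \<subseteq> P"
    and nJ: "\<not> J \<subseteq> P" and nK: "\<not> K \<subseteq> P"
  shows "J \<cdot> K \<subseteq> Q"
proof (rule ideal_prod_subset[OF Q])
  fix a k assume a: "a \<in> J" and k: "k \<in> K"
  interpret J: ideal J R by (fact J)
  interpret K: ideal K R by (fact K)
  have outside: "b \<otimes> k \<in> Q" if "b \<in> J" "b \<notin> P" for b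
  proof (rule prime_outside_mult_mem[OF P Q QP prime])
    show "b \<otimes> l \<in> P" if "l \<in> K" for l
      using ideal_prod.prod[OF \<open>b \<in> J\<close> that, of R] JKP by blast
  qed (use that nK k K.Icarr in auto)
  show "a \<otimes> k \<in> Q"
  proof (cases "a \<in> P")
    case False
    then show ?thesis using outside a by blast
  next
    case True
    obtain j where j: "j \<in> J" "j \<notin> P" using nJ by blast
    have "j \<oplus> a \<notin> P"
      using add_mem_cancel_right[OF ideal.axioms(1)[OF P]] True j by auto
    then have "a \<oplus> j \<notin> P" using a j by (simp add: a_comm)
    then have "(a \<oplus> j) \<otimes> k \<in> Q" using outside a j by simp
    then have "a \<otimes> k \<oplus> j \<otimes> k \<in> Q" using a j k by (simp add: l_distr)
    then show ?thesis
      using add_mem_cancel_right[OF ideal.axioms(1)[OF Q]] outside[OF j] a k by simp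
  qed
qed

lemma cgenideal_prod_subset:
  assumes A: "ideal A R" and ab: "a \<in> carrier R" "b \<in> carrier R" "a \<otimes> b \<in> A"
  shows "(PIdl a) \<cdot> (PIdl b) \<subseteq> A"
proof (rule ideal_prod_subset[OF A])
  fix j k assume "j \<in> PIdl a" "k \<in> PIdl b"
  then have "j \<otimes> k \<in> (PIdl a) <#> (PIdl b)"
    by (auto simp: set_mult_def)
  then have "j \<otimes> k \<in> PIdl (a \<otimes> b)"
    using cgenideal_prod ab by simp
  then show "j \<otimes> k \<in> A"
    using cgenideal_minimal[OF A] ab by blast
qed

lemma prime_outside_iff_ideal_prod:
  assumes P: "ideal P R" and Q: "ideal Q R" and QP: "Q \<subseteq> P"
  shows "prime_outside R Q P \<longleftrightarrow>
    (\<forall>J K. ideal J R \<and> ideal K R \<longrightarrow>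
       J \<cdot> K \<subseteq> P \<and> \<not> J \<cdot> K \<subseteq> Q \<longrightarrow> J \<subseteq> P \<or> K \<subseteq> P)"
proof
  assume "prime_outside R Q P"
  then show "\<forall>J K. ideal J R \<and> ideal K R \<longrightarrow>
      J \<cdot> K \<subseteq> P \<and> \<not> J \<cdot> K \<subseteq> Q \<longrightarrow> J \<subseteq> P \<or> K \<subseteq> P"
    using prime_outside_ideal_prod[OF P Q QP] by blast
next
  assume ideals: "\<forall>J K. ideal J R \<and> ideal K R \<longrightarrow>
      J \<cdot> K \<subseteq> P \<and> \<not> J \<cdot> K \<subseteq> Q \<longrightarrow> J \<subseteq> P \<or> K \<subseteq> P"
  show "prime_outside R Q P"
    unfolding prime_outside_def
  proof (intro ballI impI)
    fix a b assume ab: "a \<in> carrier R" "b \<in> carrier R" "a \<otimes> b \<in> P - Q"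
    have self: "a \<in> PIdl a" "b \<in> PIdl b"
      using ab by (simp_all add: cgenideal_self)
    then have "\<not> (PIdl a) \<cdot> (PIdl b) \<subseteq> Q"
      using ideal_prod.prod[OF self, of R] ab by blast
    moreover have "(PIdl a) \<cdot> (PIdl b) \<subseteq> P"
      using cgenideal_prod_subset[OF P] ab by blast
    ultimately have "PIdl a \<subseteq> P \<or> PIdl b \<subseteq> P"
      using ideals cgenideal_ideal ab by blast
    then show "a \<in> P \<or> b \<in> P" using self by blast
  qed
qed

end

theorem theorem2p12:
  fixes R :: "('a, 'b) ring_scheme" (structure) and I P :: "'a set"
  assumes "cring R" and "ideal I R" and "ideal P R" and "P \<noteq> carrier R"
  shows "(I_prime R I P \<longleftrightarrow>
           (\<forall>x \<in> carrier R - P. colon_ideal R P x = P \<union> colon_ideal R (I \<cdot> P) x)) \<and>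
         (I_prime R I P \<longleftrightarrow>
           (\<forall>x \<in> carrier R - P. colon_ideal R P x = P \<or>
                                colon_ideal R P x = colon_ideal R (I \<cdot> P) x)) \<and>
         (I_prime R I P \<longleftrightarrow>
           (\<forall>J K. ideal J R \<and> ideal K R \<longrightarrow>
                  J \<cdot> K \<subseteq> P \<and> \<not> J \<cdot> K \<subseteq> I \<cdot> P \<longrightarrow> J \<subseteq> P \<or> K \<subseteq> P))"
proof -
  interpret cring R by (fact assms(1))
  have Q: "ideal (I \<cdot> P) R"
    by (rule ideal_prod_is_ideal[OF assms(2,3)])
  have QP: "I \<cdot> P \<subseteq> P"
    using ideal_prod_inter[OF assms(2,3)] by blast
  have "I_prime R I P \<longleftrightarrow> prime_outside R (I \<cdot> P) P"
    using assms(3,4) by (simp add: I_prime_def prime_outside_def)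
  then show ?thesis
    using prime_outside_iff_colon_eq_Un[OF assms(3) QP]
      prime_outside_iff_colon_eq_or_eq[OF assms(3) Q QP]
      prime_outside_iff_ideal_prod[OF assms(3) Q QP]
    by (intro conjI) simp_all
qed

end
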